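(* Let $m_s = 10$, $m_w = 8$ and $p = 265/292$ (so $1-p = 27/292$). Define $(w_n)_{n\ge 0}$ by $w_0 = 0$ and $$w_n = \frac{(1-p)\,m_s\,(m_w + w_{n-1})}{m_s + p\,(m_w + w_{n-1})}\qquad (n\ge 1),$$ put $m_n = \dfrac{m_s + w_n}{m_s + m_w + w_n}$ for $n \ge 0$, and define $(c_n)_{n\ge 0}$ by $c_0 = 1$ and $$c_n = p + (1-p)\,m_{n-1}\,c_{n-1}\qquad (n\ge 1).$$ Let $m^* = \lim_{n\to\infty} m_n$. Then the sequence $(c_n)$ converges, and its limit $c^*$ (the creme fraction of the stuf of the $\infty$-Oreo) is $$c^* = \frac{p}{1-(1-p)\,m^*} = \frac{265/292}{1-(27/292)\,m^*} \approx 0.958,$$ where $\approx$ means equality after rounding to three decimals, i.e. $|c^* - 0.958| < 0.0005$. That is, the stuf of the $\infty$-Oreo is approximately $95.8\%$ creme and $4.2\%$ wafer.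
   Context: An Oreo consists of wafers and a filling (the "stuf"), which is itself a mixture of creme and wafer crumbs. The Oreo $0$-Loaded is the Mega Stuf Oreo, with pure creme filling of mass $m_s$ and wafers of total mass $m_w$ (in grams). For $n\ge1$ the Oreo $n$-Loaded is obtained by mixing a crushed Oreo $(n-1)$-Loaded into the filling of a fresh Mega Stuf Oreo; a mass fraction $p$ of the new filling is base creme, and $1-p$ is the crushed cookie. Here $w_n$ is the mass of wafer crumbs in the filling of the Oreo $n$-Loaded, $m_n$ is the mass fraction of the Oreo $n$-Loaded that is filling, and $c_n$ is the mass fraction of the filling of the Oreo $n$-Loaded that is creme. The $\infty$-Oreo is the limit of the Oreo $n$-Loaded as $n\to\infty$, so its creme fraction is $\lim_{n\to\infty} c_n$. The limit $m^*$ exists and $m^* = (m_s+w^* )/(m_s+m_w+w^* )$, where $w^*$ is the unique positive root of $p\,w^2 + p\,(m_s+m_w)\,w - (1-p)\,m_s m_w = 0$; numerically $m^* \approx 0.566$. *)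

theory Defs
  imports "HOL-Analysis.Analysis"
begin

text \<open>
  Parameters: \<open>ms\<close> is the mass of the (pure creme) filling and \<open>mw\<close> the total wafer mass of the
  Oreo 0-Loaded, in grams; \<open>p\<close> is the mass fraction of base creme in each new filling.
\<close>

text \<open>Mass of wafer crumbs in the filling of the Oreo \<open>n\<close>-Loaded.\<close>

primrec crumb_mass :: "real \<Rightarrow> real \<Rightarrow> real \<Rightarrow> nat \<Rightarrow> real" where
  "crumb_mass ms mw p 0 = 0"
| "crumb_mass ms mw p (Suc n) =
     (1 - p) * ms * (mw + crumb_mass ms mw p n) / (ms + p * (mw + crumb_mass ms mw p n))"

text \<open>Mass fraction of the Oreo \<open>n\<close>-Loaded that is filling.\<close>

definition filling_fraction :: "real \<Rightarrow> real \<Rightarrow> real \<Rightarrow> nat \<Rightarrow> real" where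
  "filling_fraction ms mw p n =
     (ms + crumb_mass ms mw p n) / (ms + mw + crumb_mass ms mw p n)"

text \<open>Mass fraction of the filling of the Oreo \<open>n\<close>-Loaded that is creme.\<close>

primrec creme_fraction :: "real \<Rightarrow> real \<Rightarrow> real \<Rightarrow> nat \<Rightarrow> real" where
  "creme_fraction ms mw p 0 = 1"
| "creme_fraction ms mw p (Suc n) =
     p + (1 - p) * filling_fraction ms mw p n * creme_fraction ms mw p n"

end

theory Submission
  imports Defs
begin

text \<open>
  The crumb recursion is a contraction with factor \<open>1 - p\<close> around the nonnegative root of its
  fixed-point quadratic, so the filling fractions converge. The creme fractions satisfy an affine
  recursion whose coefficients lie in \<open>[0, 1 - p]\<close> and converge, so their distance to the limiting
  fixed point contracts up to an error that tends to zero.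
\<close>

text \<open>Once \<open>d\<close> stays below a small threshold, unrolling the recursion leaves a
  geometric term plus a fixed small error. Taking \<open>d = 0\<close> covers plain
  contractions.\<close>

lemma perturbed_contraction_tendsto_0:
  fixes x d :: "nat \<Rightarrow> real"
  assumes q: "0 \<le> q" "q < 1"
    and nonneg: "\<And>n. 0 \<le> x n"
    and step: "\<And>n. x (Suc n) \<le> q * x n + d n"
    and d: "d \<longlonglongrightarrow> 0"
  shows "x \<longlonglongrightarrow> 0"
proof (rule LIMSEQ_I)
  fix e :: real assume e: "0 < e"
  \<comment> \<open>Chosen so that \<open>e / 2\<close> is the fixed point of
    \<open>v \<mapsto> q * v + \<delta>\<close>; the constant part of \<open>bound\<close> then
    reproduces itself in the induction.\<close>
  define \<delta> where "\<delta> = (1 - q) * (e / 2)"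
  have "0 < \<delta>" using q e by (simp add: \<delta>_def)
  then obtain N where N: "\<And>n. n \<ge> N \<Longrightarrow> d n < \<delta>"
    using order_tendstoD(2)[OF d] unfolding eventually_sequentially by metis
  have bound: "x (k + N) \<le> e / 2 + q ^ k * x N" for k
  proof (induction k)
    case 0
    then show ?case using e by simp
  next
    case (Suc k)
    have "x (Suc k + N) \<le> q * x (k + N) + \<delta>"
      using step[of "k + N"] N[of "k + N"] by simp
    also have "\<dots> \<le> q * (e / 2 + q ^ k * x N) + \<delta>"
      using Suc mult_left_mono[OF _ q(1)] by simp
    also have "\<dots> = e / 2 + q ^ Suc k * x N"
      by (simp add: \<delta>_def field_simps)
    finally show ?case .
  qed
  have "(\<lambda>k. e / 2 + q ^ k * x N) \<longlonglongrightarrow> e / 2 + 0 * x N"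
    using q by (intro tendsto_intros LIMSEQ_power_zero) auto
  then have "\<forall>\<^sub>F k in sequentially. e / 2 + q ^ k * x N < e"
    by (rule order_tendstoD(2)) (use e in simp)
  then obtain K where K: "\<And>k. k \<ge> K \<Longrightarrow> e / 2 + q ^ k * x N < e"
    unfolding eventually_sequentially by blast
  have "norm (x n - 0) < e" if "n \<ge> K + N" for n
    using bound[of "n - N"] K[of "n - N"] nonneg[of n] that le_diff_conv2[of N n K] by simp
  then show "\<exists>no. \<forall>n\<ge>no. norm (x n - 0) < e" by blast
qed

lemma crumb_mass_nonneg:
  assumes "0 < ms" "0 \<le> mw" "0 \<le> p" "p \<le> 1"
  shows "0 \<le> crumb_mass ms mw p n"
  using assms by (induction n) simp_all

text \<open>The quadratic is the fixed-point equation with its denominator cleared. Between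
  \<open>v\<close> and \<open>w\<close> the recursion has difference quotient
  \<open>(1 - p) * ms * ms / (?D v * ?D w)\<close>, and both denominators are at least
  \<open>ms\<close>.\<close>

lemma crumb_mass_tendsto:
  assumes ms: "0 < ms" and mw: "0 \<le> mw" and p: "0 < p" "p \<le> 1"
    and w: "0 \<le> w" and root: "p * w\<^sup>2 + p * (ms + mw) * w - (1 - p) * ms * mw = 0"
  shows "crumb_mass ms mw p \<longlonglongrightarrow> w"
proof -
  let ?w = "crumb_mass ms mw p"
  let ?D = "\<lambda>v. ms + p * (mw + v)"
  have D: "ms \<le> ?D v" if "0 \<le> v" for v
    using that p mw by simp
  have fixpoint: "w = (1 - p) * ms * (mw + w) / ?D w"
    using root D[OF w] ms by (simp add: field_simps power2_eq_square)
  have step: "\<bar>?w (Suc n) - w\<bar> \<le> (1 - p) * \<bar>?w n - w\<bar> + 0" for n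
  proof -
    let ?v = "?w n"
    have v: "0 \<le> ?v" using crumb_mass_nonneg ms mw p by simp
    have pos: "0 < ?D ?v" "0 < ?D w" using D[OF v] D[OF w] ms by linarith+
    have "?w (Suc n) - w = (1 - p) * ms * (mw + ?v) / ?D ?v - (1 - p) * ms * (mw + w) / ?D w"
      using fixpoint by simp
    \<comment> \<open>After cross-multiplication the terms \<open>p * (mw + ?v) * (mw + w)\<close>
      cancel, leaving \<open>ms * (?v - w)\<close>.\<close>
    also have "\<dots> = (1 - p) * (ms * ms / (?D ?v * ?D w)) * (?v - w)"
      using pos by (simp add: divide_simps) (simp add: algebra_simps)
    finally have "\<bar>?w (Suc n) - w\<bar> = (1 - p) * (ms * ms / (?D ?v * ?D w)) * \<bar>?v - w\<bar>"
      using pos p ms by (simp add: abs_mult)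
    moreover have "ms * ms / (?D ?v * ?D w) \<le> 1"
      using mult_mono[OF D[OF v] D[OF w]] pos ms by simp
    then have "(1 - p) * (ms * ms / (?D ?v * ?D w)) * \<bar>?v - w\<bar> \<le> (1 - p) * 1 * \<bar>?v - w\<bar>"
      using p by (intro mult_right_mono mult_left_mono) auto
    ultimately show ?thesis by simp
  qed
  have "(\<lambda>n. \<bar>?w n - w\<bar>) \<longlonglongrightarrow> 0"
    by (rule perturbed_contraction_tendsto_0[where q = "1 - p" and d = "\<lambda>_. 0"])
      (use p step in auto)
  then show ?thesis
    by (simp add: tendsto_rabs_zero_iff LIM_zero_iff)
qed

lemma filling_fraction_bounds:
  assumes "0 < ms" "0 \<le> mw" "0 \<le> p" "p \<le> 1"
  shows "0 \<le> filling_fraction ms mw p n" "filling_fraction ms mw p n \<le> 1"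
  using crumb_mass_nonneg[OF assms, of n] assms by (simp_all add: filling_fraction_def)

lemma creme_fraction_tendsto:
  assumes ms: "0 < ms" and mw: "0 \<le> mw" and p: "0 < p" "p \<le> 1"
    and m: "filling_fraction ms mw p \<longlonglongrightarrow> m"
  shows "creme_fraction ms mw p \<longlonglongrightarrow> p / (1 - (1 - p) * m)"
proof -
  let ?m = "filling_fraction ms mw p" and ?c = "creme_fraction ms mw p"
  define c where "c = p / (1 - (1 - p) * m)"
  have bounds: "0 \<le> ?m n" "?m n \<le> 1" for n
    using filling_fraction_bounds[of ms mw p] ms mw p by auto
  \<comment> \<open>With \<open>p > 0\<close> this gives \<open>(1 - p) * m \<le> 1 - p < 1\<close>,
    so the denominator of \<open>c\<close> is positive.\<close>
  have "m \<le> 1" using LIMSEQ_le_const2[OF m] bounds by blast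
  then have "(1 - p) * m \<le> (1 - p) * 1" using p by (intro mult_left_mono) auto
  then have "1 - (1 - p) * m > 0" using p by simp
  then have fixpoint: "c = p + (1 - p) * m * c"
    by (simp add: c_def field_simps)
  have step: "\<bar>?c (Suc n) - c\<bar> \<le> (1 - p) * \<bar>?c n - c\<bar> + \<bar>(1 - p) * c * (?m n - m)\<bar>" for n
  proof -
    \<comment> \<open>Subtract the fixed-point equation and insert
      \<open>(1 - p) * ?m n * c\<close>: the first summand contracts, the second is the perturbation
      caused by \<open>?m n\<close> differing from its limit.\<close>
    have "?c (Suc n) - c = (1 - p) * ?m n * (?c n - c) + (1 - p) * c * (?m n - m)"
      by (subst (1) fixpoint) (simp add: algebra_simps)
    then have "\<bar>?c (Suc n) - c\<bar> \<le> \<bar>(1 - p) * ?m n * (?c n - c)\<bar> + \<bar>(1 - p) * c * (?m n - m)\<bar>"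
      by (simp only: abs_triangle_ineq)
    moreover have "\<bar>(1 - p) * ?m n * (?c n - c)\<bar> = (1 - p) * ?m n * \<bar>?c n - c\<bar>"
      using p bounds[of n] by (simp add: abs_mult)
    moreover have "(1 - p) * ?m n * \<bar>?c n - c\<bar> \<le> (1 - p) * 1 * \<bar>?c n - c\<bar>"
      using p bounds[of n] by (intro mult_right_mono mult_left_mono) auto
    ultimately show ?thesis by simp
  qed
  have "(\<lambda>n. (1 - p) * c * (?m n - m)) \<longlonglongrightarrow> 0"
    using m by (intro tendsto_mult_right_zero) (simp add: LIM_zero_iff)
  then have "(\<lambda>n. \<bar>(1 - p) * c * (?m n - m)\<bar>) \<longlonglongrightarrow> 0"
    by (rule tendsto_rabs_zero)
  then have "(\<lambda>n. \<bar>?c n - c\<bar>) \<longlonglongrightarrow> 0"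
    \<comment> \<open>The rotation puts the premise on \<open>d\<close> first, so the chained limit
      instantiates \<open>d\<close>.\<close>
    by (rule perturbed_contraction_tendsto_0[rotated 4, where q = "1 - p"]) (use p step in auto)
  then have "?c \<longlonglongrightarrow> c"
    by (simp add: tendsto_rabs_zero_iff LIM_zero_iff)
  then show ?thesis by (simp add: c_def)
qed

theorem theorem3p9:
  fixes ms mw p :: real
  assumes "ms = 10" and "mw = 8" and "p = 265 / 292"
  shows "\<exists>mstar cstar :: real.
           filling_fraction ms mw p \<longlonglongrightarrow> mstar \<and>
           creme_fraction ms mw p \<longlonglongrightarrow> cstar \<and>
           cstar = p / (1 - (1 - p) * mstar) \<and>
           cstar = (265 / 292) / (1 - (27 / 292) * mstar) \<and>
           \<bar>cstar - 0.958\<bar> < 0.0005 \<and>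
           \<bar>(1 - cstar) - 0.042\<bar> < 0.0005"
proof -
  \<comment> \<open>The positive root: dividing the quadratic by \<open>p\<close> gives
    \<open>w\<^sup>2 + 18 * w = 432 / 53\<close>, that is
    \<open>(w + 9)\<^sup>2 = 4725 / 53\<close>.\<close>
  define w :: real where "w = sqrt (4725 / 53) - 9"
  define m where "m = (10 + w) / (18 + w)"
  define c where "c = (265 / 292) / (1 - (27 / 292) * m)"
  have "9.44 < sqrt (4725 / 53)" "sqrt (4725 / 53) < 9.45"
    by (rule real_less_rsqrt real_less_lsqrt; simp add: power2_eq_square)+
  then have w_bounds: "0.44 < w" "w < 0.45"
    by (simp_all add: w_def)
  have "(w + 9)\<^sup>2 = 4725 / 53" by (simp add: w_def)
  then have root: "p * w\<^sup>2 + p * (ms + mw) * w - (1 - p) * ms * mw = 0"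
    by (simp add: assms power2_eq_square algebra_simps)
  have "crumb_mass ms mw p \<longlonglongrightarrow> w"
    using root w_bounds by (intro crumb_mass_tendsto) (auto simp: assms)
  then have "(\<lambda>n. filling_fraction ms mw p n) \<longlonglongrightarrow> (ms + w) / (ms + mw + w)"
    unfolding filling_fraction_def using w_bounds by (intro tendsto_intros) (auto simp: assms)
  then have m: "filling_fraction ms mw p \<longlonglongrightarrow> m"
    by (simp add: m_def assms)
  have c: "c = p / (1 - (1 - p) * m)"
    by (simp add: c_def assms)
  have "creme_fraction ms mw p \<longlonglongrightarrow> c"
    unfolding c using m by (intro creme_fraction_tendsto) (auto simp: assms)
  \<comment> \<open>As a quotient of two affine functions of \<open>w\<close> with positive
    denominator, \<open>c\<close> can be bounded by inequalities linear in \<open>w\<close>; the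
    two-decimal bounds on \<open>w\<close> suffice for them.\<close>
  moreover have c_eq: "c = 265 * (18 + w) / (4986 + 265 * w)"
    using w_bounds by (simp add: c_def m_def field_simps)
  have "0.9575 < c" "c < 0.9585"
    using w_bounds by (simp_all add: c_eq field_simps)
  then have "\<bar>c - 0.958\<bar> < 0.0005" "\<bar>(1 - c) - 0.042\<bar> < 0.0005"
    unfolding abs_less_iff by simp_all
  ultimately show ?thesis
    using m c c_def by blast
qed

end
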